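(* For every nonnegative integer $n$, \[ L_0(n)-L_1(n)=\begin{cases}1 & \text{if } n \text{ is a triangular number},\\ 0 & \text{otherwise},\end{cases} \qquad L_2(n)-L_3(n)=\begin{cases}(-1)^n & \text{if } n \text{ is a triangular number},\\ 0 & \text{otherwise}.\end{cases} \]
   Context: A two-color partition of $n$ is a partition of $n$ in which each part is colored either blue or green; parts of the same size but different colors are regarded as different. Let $L(n)$ be the number of two-color partitions of $n$ in which all parts are distinct (i.e. no part of a given size appears twice in the same color) and odd parts may occur only in the blue color (so the green parts are distinct even numbers and the blue parts are distinct positive integers). Among the partitions counted by $L(n)$: $L_0(n)$ (resp. $L_1(n)$) is the number in which the number of blue even parts is even (resp. odd); $L_2(n)$ (resp. $L_3(n)$) is the number in which the number of blue parts is even (resp. odd). A triangular number is a number of the form $k(k+1)/2$ with $k\ge 0$ an integer. *)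

theory Defs
  imports Main "HOL-Library.Multiset"
begin

datatype color = Blue | Green

text \<open>A coloured part is a pair of a size and a colour, so equal sizes in different colours are
  different parts. A two-colour partition is a finite multiset of coloured parts.\<close>

type_synonym colored_part = "nat \<times> color"

definition two_color_partitions :: "nat \<Rightarrow> colored_part multiset set" where
  "two_color_partitions n = {P. (\<forall>p \<in># P. fst p > 0) \<and> (\<Sum>p\<in>#P. fst p) = n}"

definition L_partitions :: "nat \<Rightarrow> colored_part multiset set" where
  "L_partitions n = {P \<in> two_color_partitions n.
     (\<forall>p. count P p \<le> 1) \<and> (\<forall>p \<in># P. odd (fst p) \<longrightarrow> snd p = Blue)}"

definition blue_parts :: "colored_part multiset \<Rightarrow> nat" where
  "blue_parts P = size {#p \<in># P. snd p = Blue#}"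

definition blue_even_parts :: "colored_part multiset \<Rightarrow> nat" where
  "blue_even_parts P = size {#p \<in># P. snd p = Blue \<and> even (fst p)#}"

definition L0 :: "nat \<Rightarrow> nat" where
  "L0 n = card {P \<in> L_partitions n. even (blue_even_parts P)}"

definition L1 :: "nat \<Rightarrow> nat" where
  "L1 n = card {P \<in> L_partitions n. odd (blue_even_parts P)}"

definition L2 :: "nat \<Rightarrow> nat" where
  "L2 n = card {P \<in> L_partitions n. even (blue_parts P)}"

definition L3 :: "nat \<Rightarrow> nat" where
  "L3 n = card {P \<in> L_partitions n. odd (blue_parts P)}"

definition triangular :: "nat \<Rightarrow> bool" where
  "triangular n \<longleftrightarrow> (\<exists>k. n = k * (k + 1) div 2)"

text \<open>Finiteness, so that the cardinalities above are genuine counts.\<close>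

lemma finite_L_partitions: "finite (L_partitions n)"
proof -
  have color: "(UNIV :: color set) = {Blue, Green}"
    using color.exhaust by auto
  have "L_partitions n \<subseteq> mset_set ` Pow ({..n} \<times> UNIV)"
  proof
    fix P assume P: "P \<in> L_partitions n"
    then have d: "\<And>p. count P p \<le> 1" and s: "(\<Sum>p\<in>#P. fst p) = n"
      by (auto simp: L_partitions_def two_color_partitions_def)
    have "P = mset_set (set_mset P)"
    proof (rule multiset_eqI)
      fix p
      show "count P p = count (mset_set (set_mset P)) p"
        using d[of p] by (cases "p \<in># P") (auto simp: count_eq_zero_iff le_Suc_eq)
    qed
    moreover have "fst p \<le> n" if p: "p \<in># P" for p
    proof -
      obtain Q where "P = add_mset p Q" using multi_member_split[OF p] by blast
      then show ?thesis using s by simp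
    qed
    then have "set_mset P \<in> Pow ({..n} \<times> UNIV)"
      by (auto simp: mem_Times_iff)
    ultimately show "P \<in> mset_set ` Pow ({..n} \<times> UNIV)"
      by (rule image_eqI)
  qed
  then show ?thesis
    by (rule finite_subset) (simp add: color)
qed

end

theory Submission
  imports Defs "HOL-Computational_Algebra.Polynomial"
begin

text \<open>
  The generating function of \<open>L\<^sub>0 - L\<^sub>1\<close> is
  \<open>\<Prod>\<^sub>i (1 + q\<^bsup>2i-1\<^esup>) (1 - q\<^bsup>2i\<^esup>) (1 + q\<^bsup>2i\<^esup>)\<close>, so the first claim is Gauss's triangular number identity.
  Shanks's finite form of that identity holds over any commutative ring; modulo
  \<open>q\<^bsup>2n+1\<^esup>\<close> it says that \<open>\<Prod>\<^sub>i (1 - q\<^bsup>2i\<^esup>)\<close> is \<open>\<Prod>\<^sub>i (1 - q\<^bsup>2i-1\<^esup>)\<close> times the sum of the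
  \<open>q\<^bsup>s(s+1)/2\<^esup>\<close>, and Euler's \<open>\<Prod>\<^sub>i (1 - q\<^bsup>2i-1\<^esup>) (1 + q\<^bsup>i\<^esup>) = 1\<close> moves the odd factors across.
  For the second claim, all odd parts are blue, so the number of odd blue parts is congruent
  to \<open>n\<close> modulo 2, and the two signs differ by \<open>(-1)\<^sup>n\<close>.
\<close>

section \<open>Shanks's and Euler's identities, division-free over a commutative ring\<close>

context
  fixes x :: "'a::comm_ring_1"
begin

definition odd_prod :: "nat \<Rightarrow> 'a" where
  "odd_prod n = (\<Prod>i<n. 1 - x ^ (2 * i + 1))"

definition even_prod :: "nat \<Rightarrow> 'a" where
  "even_prod n = (\<Prod>i<n. 1 - x ^ (2 * i + 2))"

definition plus_prod :: "nat \<Rightarrow> 'a" where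
  "plus_prod n = (\<Prod>i<n. (1 + x ^ (2 * i + 1)) * (1 + x ^ (2 * i + 2)))"

definition triangular_sum :: "nat \<Rightarrow> 'a" where
  "triangular_sum m = (\<Sum>s<m. x ^ (s * (s + 1) div 2))"

text \<open>Shanks's summand \<open>(P n / P s) * x ^ (s * (2 * n + 1))\<close>, where
  \<open>P n = even_prod n / odd_prod n\<close>, multiplied by \<open>odd_prod n\<close> to clear
  the denominators.\<close>

definition shanks_term :: "nat \<Rightarrow> nat \<Rightarrow> 'a" where
  "shanks_term n s = (\<Prod>i=s..<n. 1 - x ^ (2 * i + 2)) * odd_prod s * x ^ (s * (2 * n + 1))"

lemma odd_prod_Suc: "odd_prod (Suc n) = odd_prod n * (1 - x ^ (2 * n + 1))"
  by (simp add: odd_prod_def)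

lemma even_prod_Suc: "even_prod (Suc n) = even_prod n * (1 - x ^ (2 * n + 2))"
  by (simp add: even_prod_def)

lemma shanks_term_Suc_left:
  assumes "s \<le> n"
  shows "shanks_term (Suc n) s = shanks_term n s * (1 - x ^ (2 * n + 2)) * x ^ (2 * s)"
proof -
  have e: "s * (2 * Suc n + 1) = s * (2 * n + 1) + 2 * s" by (simp add: algebra_simps)
  show ?thesis
    using assms unfolding shanks_term_def e power_add[of x "s * (2 * n + 1)"]
    by (simp add: mult_ac)
qed

lemma shanks_term_Suc_right:
  assumes "s < n"
  shows "shanks_term n (Suc s) * (1 - x ^ (2 * s + 2)) =
    shanks_term n s * x ^ (2 * n + 1) * (1 - x ^ (2 * s + 1))"
proof -
  have e: "Suc s * (2 * n + 1) = s * (2 * n + 1) + (2 * n + 1)" by (simp add: algebra_simps)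
  show ?thesis
    using assms unfolding shanks_term_def e power_add[of x "s * (2 * n + 1)"] odd_prod_Suc
    by (simp only: prod.atLeast_Suc_lessThan mult_ac)
qed

lemma shanks_term_diag: "shanks_term n n = odd_prod n * x ^ (n * (2 * n + 1))"
  by (simp add: shanks_term_def)

text \<open>When \<open>n\<close> grows by one, the change in the summands telescopes in
  \<open>s\<close>; what is left at \<open>s = n\<close> supplies exactly the two new triangular
  powers.\<close>

lemma shanks_identity: "odd_prod n * triangular_sum (2 * n) = (\<Sum>s<n. shanks_term n s)"
proof (induction n)
  case 0
  show ?case by (simp add: triangular_sum_def)
next
  case (Suc n)
  \<comment> \<open>The antidifference. Its extra factor is the one
    \<open>shanks_term_Suc_right\<close> needs at \<open>Suc s\<close>, and it vanishes at
    \<open>s = 0\<close>, so only the upper boundary survives.\<close>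
  define u where "u s = shanks_term n s * (1 - x ^ (2 * s))" for s
  have step: "shanks_term (Suc n) s - (1 - x ^ (2 * n + 1)) * shanks_term n s = u (Suc s) - u s"
    if "s < n" for s
  proof -
    have "u (Suc s) = shanks_term n s * x ^ (2 * n + 1) * (1 - x ^ (2 * s + 1))"
      using shanks_term_Suc_right[OF that] by (simp add: u_def)
    moreover have "shanks_term (Suc n) s = shanks_term n s * (1 - x ^ (2 * n + 2)) * x ^ (2 * s)"
      using shanks_term_Suc_left that by simp
    moreover have "u s = shanks_term n s * (1 - x ^ (2 * s))"
      by (simp add: u_def)
    ultimately show ?thesis
      by (simp only:) (simp add: algebra_simps power_add)
  qed
  have "(\<Sum>s<n. shanks_term (Suc n) s) - (1 - x ^ (2 * n + 1)) * (\<Sum>s<n. shanks_term n s)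
      = (\<Sum>s<n. u (Suc s) - u s)"
    unfolding sum_distrib_left sum_subtractf[symmetric] using step by (intro sum.cong) auto
  also have "\<dots> = shanks_term n n * (1 - x ^ (2 * n))"
    unfolding sum_lessThan_telescope by (simp add: u_def)
  finally have "(\<Sum>s<Suc n. shanks_term (Suc n) s) =
      (1 - x ^ (2 * n + 1)) * (odd_prod n * triangular_sum (2 * n))
      + shanks_term n n * (1 - x ^ (2 * n)) + shanks_term (Suc n) n"
    unfolding Suc.IH by (simp add: algebra_simps)
  also have "shanks_term (Suc n) n = shanks_term n n * (1 - x ^ (2 * n + 2)) * x ^ (2 * n)"
    by (rule shanks_term_Suc_left) simp
  \<comment> \<open>The cofactors of \<open>shanks_term n n\<close> add up to
    \<open>1 - x ^ (4 * n + 2)\<close>, a difference of squares containing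
    \<open>1 - x ^ (2 * n + 1)\<close>.\<close>
  also have "(1 - x ^ (2 * n + 1)) * (odd_prod n * triangular_sum (2 * n))
      + shanks_term n n * (1 - x ^ (2 * n)) + shanks_term n n * (1 - x ^ (2 * n + 2)) * x ^ (2 * n)
      = odd_prod n * (1 - x ^ (2 * n + 1))
        * (triangular_sum (2 * n) + x ^ (n * (2 * n + 1)) * (1 + x ^ (2 * n + 1)))"
    unfolding shanks_term_diag by (simp add: algebra_simps power_add)
  also have "triangular_sum (2 * n) + x ^ (n * (2 * n + 1)) * (1 + x ^ (2 * n + 1))
      = triangular_sum (2 * Suc n)"
  proof -
    \<comment> \<open>The two new exponents are the triangular numbers of index \<open>2 * n\<close>
      and \<open>2 * n + 1\<close>.\<close>
    have "(2 * n) * (2 * n + 1) div 2 = n * (2 * n + 1)"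
      by (metis mult.assoc nonzero_mult_div_cancel_left zero_neq_numeral)
    moreover have "Suc (2 * n) * (Suc (2 * n) + 1) = 2 * (n * (2 * n + 1) + (2 * n + 1))"
      by (simp add: algebra_simps)
    then have "Suc (2 * n) * (Suc (2 * n) + 1) div 2 = n * (2 * n + 1) + (2 * n + 1)"
      by (metis nonzero_mult_div_cancel_left zero_neq_numeral)
    ultimately show ?thesis
      by (simp only: triangular_sum_def mult_Suc_right add_2_eq_Suc sum.lessThan_Suc
          power_add distrib_left mult_1_right add.assoc mult.assoc)
  qed
  finally show ?case by (simp only: odd_prod_Suc)
qed

text \<open>In Shanks's sum the term \<open>s = 0\<close> is \<open>even_prod n\<close>, and every
  later term carries a power of at least \<open>2 * n + 1\<close>.\<close>

lemma odd_prod_triangular_sum_cong: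
  assumes "0 < n"
  shows "x ^ (2 * n + 1) dvd odd_prod n * triangular_sum (2 * n) - even_prod n"
proof -
  have "shanks_term n 0 = even_prod n"
    by (simp add: shanks_term_def odd_prod_def even_prod_def lessThan_atLeast0)
  then have "odd_prod n * triangular_sum (2 * n) - even_prod n = (\<Sum>s\<in>{..<n} - {0}. shanks_term n s)"
    using assms by (simp add: shanks_identity sum.remove[of "{..<n}" 0])
  also have "x ^ (2 * n + 1) dvd \<dots>"
  proof (intro dvd_sum)
    fix s assume "s \<in> {..<n} - {0}"
    then have "2 * n + 1 \<le> s * (2 * n + 1)" by (cases s) auto
    then show "x ^ (2 * n + 1) dvd shanks_term n s"
      unfolding shanks_term_def by (intro dvd_mult le_imp_power_dvd)
  qed
  finally show ?thesis .
qed

lemma even_prod_cong: "n \<le> m \<Longrightarrow> x ^ (2 * n + 1) dvd even_prod m - even_prod n"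
proof (induction m rule: dec_induct)
  case base
  show ?case by simp
next
  case (step m)
  have "even_prod (Suc m) - even_prod n
      = (even_prod m - even_prod n) - even_prod m * x ^ (2 * m + 2)"
    by (simp add: even_prod_Suc algebra_simps)
  moreover have "x ^ (2 * n + 1) dvd x ^ (2 * m + 2)"
    using step.hyps by (intro le_imp_power_dvd) simp
  ultimately show ?case
    using step.IH by (metis dvd_diff dvd_mult)
qed

text \<open>The first two products together run over all \<open>1 - x ^ j\<close> with
  \<open>1 \<le> j \<le> 2 * n\<close>, and \<open>plus_prod n\<close> over all
  \<open>1 + x ^ j\<close>; pairing equal \<open>j\<close> gives
  \<open>1 - x ^ (2 * j)\<close>.\<close>

lemma euler_identity: "even_prod n * odd_prod n * plus_prod n = even_prod (2 * n)"
proof (induction n)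
  case 0
  show ?case by (simp add: even_prod_def odd_prod_def plus_prod_def)
next
  case (Suc n)
  have sq: "(1 - y) * (1 + y) = 1 - y * y" for y :: 'a
    by (simp add: algebra_simps)
  have "even_prod (Suc n) * odd_prod (Suc n) * plus_prod (Suc n)
      = even_prod n * odd_prod n * plus_prod n
        * ((1 - x ^ (2 * n + 1)) * (1 + x ^ (2 * n + 1)))
        * ((1 - x ^ (2 * n + 2)) * (1 + x ^ (2 * n + 2)))"
    by (simp only: even_prod_Suc odd_prod_Suc plus_prod_def prod.lessThan_Suc mult_ac)
  also have "\<dots> = even_prod (2 * n) * (1 - x ^ (2 * (2 * n) + 2))
        * (1 - x ^ (2 * Suc (2 * n) + 2))"
    unfolding Suc.IH sq power_add[symmetric] by (simp add: mult_2)
  also have "\<dots> = even_prod (2 * Suc n)"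
    by (simp only: mult_Suc_right add_2_eq_Suc even_prod_Suc)
  finally show ?case .
qed

text \<open>Multiply Shanks's congruence by \<open>even_prod n * plus_prod n\<close> and apply
  Euler's identity. The common factor \<open>even_prod n\<close> is cancelled only later, over
  polynomials.\<close>

lemma even_prod_mult_triangular_sum_cong:
  assumes "0 < n"
  shows "x ^ (2 * n + 1) dvd
    even_prod n * (triangular_sum (2 * n) - plus_prod n * even_prod n)"
proof -
  define S where "S = triangular_sum (2 * n)"
  have "even_prod n * (S - plus_prod n * even_prod n)
      = even_prod n * plus_prod n * (odd_prod n * S - even_prod n)
        - (even_prod n * odd_prod n * plus_prod n - even_prod n) * S"
    by (simp add: algebra_simps)
  then show ?thesis
    using odd_prod_triangular_sum_cong[OF assms] even_prod_cong[of n "2 * n"]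
    by (simp add: S_def euler_identity)
qed

end

section \<open>Gauss's identity for polynomial coefficients\<close>

lemma X_power: "monom (1::'a::comm_semiring_1) 1 ^ m = monom 1 m"
  by (simp add: monom_power)

text \<open>A nonzero constant term means order 0 at 0, so \<open>q\<close> alone accounts for the
  order of \<open>p * q\<close> there.\<close>

lemma X_power_dvd_mult_cancel:
  fixes p q :: "'a::idom poly"
  assumes "monom 1 1 ^ m dvd p * q" "coeff p 0 \<noteq> 0"
  shows "monom 1 1 ^ m dvd q"
proof (cases "q = 0")
  case False
  have p: "p \<noteq> 0" "order 0 p = 0"
    using assms(2) by (auto simp: order_0I poly_0_coeff_0)
  then show ?thesis
    using assms(1) False by (simp add: monom_power monom_1_dvd_iff order_mult)
qed simp

theorem gauss_triangular_coeff:
  assumes "0 < n" "k \<le> 2 * n"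
  shows "coeff (plus_prod (monom 1 1) n * even_prod (monom 1 1) n) k
    = coeff (triangular_sum (monom (1::int) 1) (2 * n)) k"
proof -
  let ?X = "monom (1::int) 1"
  have "coeff (even_prod ?X n) 0 = 1"
    by (simp add: even_prod_def poly_prod poly_monom flip: poly_0_coeff_0)
  then have "?X ^ (2 * n + 1) dvd triangular_sum ?X (2 * n) - plus_prod ?X n * even_prod ?X n"
    using even_prod_mult_triangular_sum_cong[OF assms(1), of ?X] X_power_dvd_mult_cancel
    by fastforce
  then show ?thesis
    using assms(2) unfolding X_power by (simp add: monom_1_dvd_iff')
qed

section \<open>Coefficients of the triangular sum\<close>

lemma triangular_number_strict_mono: "strict_mono (\<lambda>s::nat. s * (s + 1) div 2)"
  unfolding strict_mono_Suc_iff
proof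
  fix s :: nat
  have "Suc s * (Suc s + 1) = s * (s + 1) + Suc s * 2" by (simp add: algebra_simps)
  then show "s * (s + 1) div 2 < Suc s * (Suc s + 1) div 2" by simp
qed

lemma coeff_triangular_sum:
  assumes "n < m"
  shows "coeff (triangular_sum (monom (1::int) 1) m) n = (if triangular n then 1 else 0)"
proof -
  let ?t = "\<lambda>s::nat. s * (s + 1) div 2"
  have c: "coeff (triangular_sum (monom (1::int) 1) m) n = (\<Sum>s<m. if ?t s = n then 1 else 0)"
    by (simp add: triangular_sum_def coeff_sum monom_power)
  show ?thesis
  proof (cases "triangular n")
    case True
    then obtain k where k: "n = ?t k" by (auto simp: triangular_def)
    have "?t s = n \<longleftrightarrow> s = k" for s
      using strict_mono_eq[OF triangular_number_strict_mono] k by blast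
    \<comment> \<open>A strictly increasing function on the naturals satisfies
      \<open>k \<le> ?t k\<close>, so the index of the triangular number \<open>n\<close> lies
      within the truncated sum.\<close>
    moreover have "k < m"
      using strict_mono_imp_increasing[OF triangular_number_strict_mono, of k] k assms by simp
    ultimately show ?thesis using True unfolding c by simp
  next
    case False
    then have "?t s \<noteq> n" for s by (auto simp: triangular_def)
    then show ?thesis using False unfolding c by simp
  qed
qed

section \<open>Signed generating function of the partitions\<close>

definition L_parts :: "nat \<Rightarrow> colored_part set" where
  "L_parts N = {p. 0 < fst p \<and> fst p \<le> 2 * N \<and> (odd (fst p) \<longrightarrow> snd p = Blue)}"

definition part_sign :: "colored_part \<Rightarrow> int" where
  "part_sign p = (if snd p = Blue \<and> even (fst p) then -1 else 1)"

lemma L_parts_0: "L_parts 0 = {}"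
  by (auto simp: L_parts_def)

lemma L_parts_Suc:
  "L_parts (Suc N) = insert (2 * N + 1, Blue) (insert (2 * N + 2, Blue)
     (insert (2 * N + 2, Green) (L_parts N)))"
proof (rule set_eqI)
  fix p :: colored_part
  obtain k c where [simp]: "p = (k, c)" by fastforce
  show "p \<in> L_parts (Suc N) \<longleftrightarrow> p \<in> insert (2 * N + 1, Blue) (insert (2 * N + 2, Blue)
     (insert (2 * N + 2, Green) (L_parts N)))"
    by (cases c) (auto simp: L_parts_def le_Suc_eq)
qed

lemma finite_L_parts: "finite (L_parts N)"
proof (induction N)
  case 0
  show ?case by (simp add: L_parts_0)
qed (simp add: L_parts_Suc)

text \<open>Blue even parts give the factors of \<open>even_prod\<close>; blue odd and green even
  parts give those of \<open>plus_prod\<close>.\<close>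

lemma prod_L_parts:
  "(\<Prod>p\<in>L_parts N. 1 + monom (part_sign p) (fst p))
    = plus_prod (monom 1 1) N * even_prod (monom 1 1) N"
proof (induction N)
  case 0
  show ?case by (simp add: L_parts_0 plus_prod_def even_prod_def)
next
  case (Suc N)
  have "(2 * N + 1, Blue) \<notin> L_parts N" "(2 * N + 2, c) \<notin> L_parts N" for c
    by (auto simp: L_parts_def)
  then have "(\<Prod>p\<in>L_parts (Suc N). 1 + monom (part_sign p) (fst p))
      = (1 + monom 1 (2 * N + 1)) * ((1 + monom (-1) (2 * N + 2)) * ((1 + monom 1 (2 * N + 2))
        * (\<Prod>p\<in>L_parts N. 1 + monom (part_sign p) (fst p))))"
    using finite_L_parts[of N] by (simp add: L_parts_Suc part_sign_def)
  also have "1 + monom (-1) (2 * N + 2) = 1 - monom (1::int) (2 * N + 2)"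
    by (simp add: minus_monom[symmetric])
  finally show ?case
    unfolding Suc.IH plus_prod_def even_prod_def X_power prod.lessThan_Suc by (simp only: mult_ac)
qed

text \<open>Multiplicities are at most one, so a partition is determined by its set of parts, and no
  part exceeds \<open>n \<le> 2 * N\<close>.\<close>

lemma L_partitions_eq_image:
  assumes "n \<le> 2 * N"
  shows "L_partitions n = mset_set ` {S \<in> Pow (L_parts N). sum fst S = n}"
proof (intro equalityI subsetI)
  fix P assume P: "P \<in> L_partitions n"
  have eq: "P = mset_set (set_mset P)"
  proof (rule multiset_eqI)
    fix p
    have "count P p \<le> 1" using P by (cases p) (simp add: L_partitions_def)
    then show "count P p = count (mset_set (set_mset P)) p"
      by (cases "p \<in># P") (auto simp: count_eq_zero_iff le_Suc_eq)
  qed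
  have "(\<Sum>p\<in>#P. fst p) = n"
    using P by (simp add: L_partitions_def two_color_partitions_def)
  then have s: "sum fst (set_mset P) = n"
    by (subst (asm) eq) (simp add: sum_unfold_sum_mset)
  moreover have "fst p \<le> 2 * N" if "p \<in># P" for p
    using member_le_sum[of p "set_mset P" fst] that s assms by simp
  then have "set_mset P \<subseteq> L_parts N"
    using P by (auto simp: L_parts_def L_partitions_def two_color_partitions_def)
  ultimately show "P \<in> mset_set ` {S \<in> Pow (L_parts N). sum fst S = n}"
    using eq by blast
next
  fix P assume "P \<in> mset_set ` {S \<in> Pow (L_parts N). sum fst S = n}"
  then obtain S where S: "P = mset_set S" "S \<subseteq> L_parts N" "sum fst S = n" by blast
  moreover have "finite S" using S(2) finite_L_parts finite_subset by blast
  ultimately show "P \<in> L_partitions n"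
    by (auto simp: L_partitions_def two_color_partitions_def L_parts_def sum_unfold_sum_mset
        count_mset_set')
qed

lemma prod_part_sign:
  assumes "finite S"
  shows "(\<Prod>p\<in>S. part_sign p) = (-1) ^ blue_even_parts (mset_set S)"
  using assms by induction (auto simp: part_sign_def blue_even_parts_def)

text \<open>Expanding the product chooses a subset of the admissible parts; its monomial records the
  total size as degree and the sign as coefficient.\<close>

lemma signed_count_eq_coeff:
  assumes "n \<le> 2 * N"
  shows "(\<Sum>P\<in>L_partitions n. (-1) ^ blue_even_parts P)
    = coeff (\<Prod>p\<in>L_parts N. 1 + monom (part_sign p) (fst p)) n"
proof -
  let ?U = "L_parts N"
  have fin: "finite S" if "S \<subseteq> ?U" for S
    using that finite_L_parts finite_subset by blast
  have monom: "(\<Prod>p\<in>S. monom (part_sign p) (fst p))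
      = monom ((-1) ^ blue_even_parts (mset_set S)) (sum fst S)" if "S \<subseteq> ?U" for S
  proof -
    have "(\<Prod>p\<in>S. monom (part_sign p) (fst p)) = monom (\<Prod>p\<in>S. part_sign p) (sum fst S)"
      using fin[OF that] by induction (auto simp: mult_monom)
    then show ?thesis using prod_part_sign[OF fin[OF that]] by simp
  qed
  have "(\<Prod>p\<in>?U. 1 + monom (part_sign p) (fst p))
      = (\<Sum>S\<in>Pow ?U. \<Prod>p\<in>S. monom (part_sign p) (fst p))"
    using prod_add[OF finite_L_parts, of "\<lambda>p. monom (part_sign p) (fst p)" "\<lambda>_. 1"]
    by (simp add: add.commute)
  also have "\<dots> = (\<Sum>S\<in>Pow ?U. monom ((-1) ^ blue_even_parts (mset_set S)) (sum fst S))"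
    by (intro sum.cong) (auto simp: monom)
  finally have "coeff (\<Prod>p\<in>?U. 1 + monom (part_sign p) (fst p)) n
      = (\<Sum>S\<in>Pow ?U. if sum fst S = n then (-1) ^ blue_even_parts (mset_set S) else 0)"
    by (simp add: coeff_sum)
  also have "\<dots> = (\<Sum>S\<in>{S \<in> Pow ?U. sum fst S = n}. (-1) ^ blue_even_parts (mset_set S))"
    by (rule sum.inter_filter[symmetric]) (simp add: finite_L_parts)
  also have "\<dots> = (\<Sum>P\<in>L_partitions n. (-1) ^ blue_even_parts P)"
  proof -
    have "inj_on mset_set {S \<in> Pow ?U. sum fst S = n}"
      by (rule inj_onI) (metis (no_types, lifting) Pow_iff fin finite_set_mset_mset_set mem_Collect_eq)
    then show ?thesis
      unfolding L_partitions_eq_image[OF assms] by (simp add: sum.reindex)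
  qed
  finally show ?thesis by simp
qed

section \<open>From signed sums to the two differences\<close>

lemma card_even_minus_card_odd:
  assumes "finite A"
  shows "int (card {a \<in> A. even (f a)}) - int (card {a \<in> A. odd (f a)}) = (\<Sum>a\<in>A. (-1) ^ f a)"
proof -
  have "(\<Sum>a\<in>A. (-1) ^ f a)
      = (\<Sum>a\<in>{a \<in> A. even (f a)}. (-1) ^ f a) + (\<Sum>a\<in>{a \<in> A. odd (f a)}. (-1::int) ^ f a)"
    using assms by (subst sum.union_disjoint[symmetric]) (auto intro!: sum.cong)
  then show ?thesis by simp
qed

text \<open>Part by part: an odd part, being blue, flips the left side and the size sign; a blue
  even part flips the left side and the last factor; a green even part flips nothing.\<close>

lemma blue_parts_sign:
  assumes "\<forall>p\<in>#P. odd (fst p) \<longrightarrow> snd p = Blue"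
  shows "(-1::int) ^ blue_parts P = (-1) ^ (\<Sum>p\<in>#P. fst p) * (-1) ^ blue_even_parts P"
  using assms
  by (induction P) (auto simp: blue_parts_def blue_even_parts_def power_add)

theorem theorem1p7:
  fixes n :: nat
  shows "int (L0 n) - int (L1 n) = (if triangular n then 1 else 0)
       \<and> int (L2 n) - int (L3 n) = (if triangular n then (-1) ^ n else 0)"
proof -
  \<comment> \<open>The truncation \<open>Suc n\<close> is positive and
    \<open>n < 2 * Suc n\<close>, so all bounds hold, also for \<open>n = 0\<close>.\<close>
  have "(\<Sum>P\<in>L_partitions n. (-1) ^ blue_even_parts P)
      = coeff (triangular_sum (monom (1::int) 1) (2 * Suc n)) n"
    using signed_count_eq_coeff[of n "Suc n"] gauss_triangular_coeff[of "Suc n" n]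
    by (simp add: prod_L_parts)
  also have "\<dots> = (if triangular n then 1 else 0)"
    by (rule coeff_triangular_sum) simp
  finally have even: "(\<Sum>P\<in>L_partitions n. (-1) ^ blue_even_parts P)
      = (if triangular n then 1 else 0 :: int)" .
  have "(\<Sum>P\<in>L_partitions n. (-1::int) ^ blue_parts P)
      = (\<Sum>P\<in>L_partitions n. (-1) ^ n * (-1) ^ blue_even_parts P)"
    by (intro sum.cong)
      (auto simp: blue_parts_sign L_partitions_def two_color_partitions_def)
  also have "\<dots> = (-1) ^ n * (if triangular n then 1 else 0)"
    unfolding sum_distrib_left[symmetric] even ..
  finally show ?thesis
    using even card_even_minus_card_odd[OF finite_L_partitions]
    by (simp add: L0_def L1_def L2_def L3_def)
qed

end
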